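(* Let $A$ be an algebra in a variety $\mathcal V$ of type $\mathcal F$, and let $F\colon A\to\mathsf{Set}_*$ be an outer semidirect product of $A$. Then $F$ can be extended to a functor $G\colon\mathcal C_A\to\mathsf{Set}_*$ from the enveloping category $\mathcal C_A$ of $A$ by defining, on objects, $$G(a_1,\dots,a_n)=F(a_1)\times\dots\times F(a_n),$$ and, on a morphism $(p_1,\dots,p_m)\colon(a_1,\dots,a_n)\to(b_1,\dots,b_m)$ of $\mathcal C_A$, $$G(p_1,\dots,p_m)=(F(p_1),\dots,F(p_m))\colon F(a_1)\times\dots\times F(a_n)\to F(b_1)\times\dots\times F(b_m),$$ the map whose $j$-th component is $F(p_j)\colon F(a_1)\times\dots\times F(a_n)\to F(p_j(a_1,\dots,a_n))=F(b_j)$.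
   Context: $\mathsf{Set}_*$ is the category of pointed sets (morphisms are base-point preserving maps; products are cartesian products with the tuple of base points as base point; the empty product is a one-point set). Outer semidirect product. Let $A$ be an algebra in a variety $\mathcal V$ of type $\mathcal F$. An outer semidirect product of $A$, written $F\colon A\to\mathsf{Set}_*$, assigns to each element $a\in A$ a pointed set $F(a)=(X_a,x_a)$, and to each $n$-ary function symbol $f\in\mathcal F$ and each $(a_1,\dots,a_n)\in A^n$ a morphism in $\mathsf{Set}_*$ $$f_{(a_1,\dots,a_n)}\colon (X_{a_1},x_{a_1})\times\dots\times(X_{a_n},x_{a_n})\to(X_{f(a_1,\dots,a_n)},x_{f(a_1,\dots,a_n)}),$$ in such a way that the disjoint union $\widehat A:=\bigcup_{a\in A}(X_a\times\{a\})$ with the operations $$f((u_1,a_1),\dots,(u_n,a_n))=(f_{(a_1,\dots,a_n)}(u_1,\dots,u_n),f(a_1,\dots,a_n))\qquad (u_i\in X_{a_i})$$ for every $f\in\mathcal F$ is an algebra in $\mathcal V$. Enveloping category $\mathcal C_A$. Its objects are all $n$-tuples $(a_1,\dots,a_n)$ of elements of $A$, for arbitrary integers $n\ge0$. A morphism $(a_1,\dots,a_n)\to(b_1,\dots,b_m)$ is any $m$-tuple $(p_1,\dots,p_m)$ of $n$-ary terms of type $\mathcal F$ (formal terms in the variables $x_1,\dots,x_n$) such that $p_j(a_1,\dots,a_n)=b_j$ in $A$ for every $j=1,\dots,m$. Composition is substitution of terms: $(q_1,\dots,q_r)\circ(p_1,\dots,p_m)=(q_1(p_1,\dots,p_m),\dots,q_r(p_1,\dots,p_m))$.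 Value of $F$ on terms. For an $n$-ary term $p$ and $(a_1,\dots,a_n)\in A^n$, $F(p)\colon F(a_1)\times\dots\times F(a_n)\to F(p(a_1,\dots,a_n))$ is the map obtained from the maps $f_{(\dots)}$ by recursion on the term $p$ (a variable $x_i$ gives the $i$-th projection); equivalently, it is the map determined by $p^{\widehat A}((u_1,a_1),\dots,(u_n,a_n))=(F(p)(u_1,\dots,u_n),p(a_1,\dots,a_n))$, where $p^{\widehat A}$ is the term operation on $\widehat A$. "$G$ extends $F$" means that $G$ takes the value $F(a)$ on each $1$-tuple $(a)$ and the value $f_{(a_1,\dots,a_n)}$ on the morphism $(f(x_1,\dots,x_n))\colon(a_1,\dots,a_n)\to(f(a_1,\dots,a_n))$ for each $n$-ary $f\in\mathcal F$. *)

theory Defs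
  imports Main "HOL-Library.FuncSet"
begin

text \<open>A type of algebras is given by a HOL type of function symbols and an arity function
  \<open>ar\<close>. The variables are \<open>Var 0, Var 1, ...\<close>, so the variable written \<open>x\<^sub>i\<close> on paper
  (with \<open>i = 1, ..., n\<close>) is \<open>Var (i - 1)\<close>.\<close>

datatype 'f trm = Var nat | App 'f "'f trm list"

fun nary :: "('f \<Rightarrow> nat) \<Rightarrow> nat \<Rightarrow> 'f trm \<Rightarrow> bool" where
  "nary ar n (Var i) \<longleftrightarrow> i < n"
| "nary ar n (App f ts) \<longleftrightarrow> length ts = ar f \<and> (\<forall>t \<in> set ts. nary ar n t)"

primrec subst :: "'f trm list \<Rightarrow> 'f trm \<Rightarrow> 'f trm" where
  "subst ps (Var i) = ps ! i"
| "subst ps (App f ts) = App f (map (subst ps) ts)"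

record ('f, 'a) alg =
  carrier :: "'a set"
  interp :: "'f \<Rightarrow> 'a list \<Rightarrow> 'a"

definition algebra :: "('f \<Rightarrow> nat) \<Rightarrow> ('f, 'a) alg \<Rightarrow> bool" where
  "algebra ar A \<longleftrightarrow>
    (\<forall>f as. length as = ar f \<and> set as \<subseteq> carrier A \<longrightarrow> interp A f as \<in> carrier A)"

primrec eval :: "('f, 'a) alg \<Rightarrow> (nat \<Rightarrow> 'a) \<Rightarrow> 'f trm \<Rightarrow> 'a" where
  "eval A v (Var i) = v i"
| "eval A v (App f ts) = interp A f (map (eval A v) ts)"

abbreviation term_op :: "('f, 'a) alg \<Rightarrow> 'f trm \<Rightarrow> 'a list \<Rightarrow> 'a" where
  "term_op A p as \<equiv> eval A (\<lambda>i. as ! i) p"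

text \<open>A variety is an equational class. It is represented by a set \<open>E\<close> of identities, and
  membership is a polymorphic predicate, because the algebras of one variety have carriers in
  different HOL types.\<close>

definition identities :: "('f \<Rightarrow> nat) \<Rightarrow> ('f trm \<times> 'f trm) set \<Rightarrow> bool" where
  "identities ar E \<longleftrightarrow> (\<forall>(s, t) \<in> E. \<exists>n. nary ar n s \<and> nary ar n t)"

definition in_variety ::
    "('f \<Rightarrow> nat) \<Rightarrow> ('f trm \<times> 'f trm) set \<Rightarrow> ('f, 'a) alg \<Rightarrow> bool" where
  "in_variety ar E A \<longleftrightarrow> algebra ar A \<and>
    (\<forall>(s, t) \<in> E. \<forall>v. range v \<subseteq> carrier A \<longrightarrow> eval A v s = eval A v t)"

text \<open>Hom-sets of different pairs of objects need not be disjoint, so composition and the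
  action of a functor on morphisms take the objects as arguments: \<open>comp C a b c g f\<close> is
  the composite of \<open>f : a \<rightarrow> b\<close> and \<open>g : b \<rightarrow> c\<close>.\<close>

record ('o, 'm) cat =
  Ob :: "'o set"
  Hom :: "'o \<Rightarrow> 'o \<Rightarrow> 'm set"
  ident :: "'o \<Rightarrow> 'm"
  comp :: "'o \<Rightarrow> 'o \<Rightarrow> 'o \<Rightarrow> 'm \<Rightarrow> 'm \<Rightarrow> 'm"

definition is_category :: "('o, 'm) cat \<Rightarrow> bool" where
  "is_category C \<longleftrightarrow>
    (\<forall>a \<in> Ob C. ident C a \<in> Hom C a a) \<and>
    (\<forall>a \<in> Ob C. \<forall>b \<in> Ob C. \<forall>c \<in> Ob C. \<forall>f \<in> Hom C a b. \<forall>g \<in> Hom C b c.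
      comp C a b c g f \<in> Hom C a c) \<and>
    (\<forall>a \<in> Ob C. \<forall>b \<in> Ob C. \<forall>f \<in> Hom C a b.
      comp C a a b f (ident C a) = f \<and> comp C a b b (ident C b) f = f) \<and>
    (\<forall>a \<in> Ob C. \<forall>b \<in> Ob C. \<forall>c \<in> Ob C. \<forall>d \<in> Ob C.
      \<forall>f \<in> Hom C a b. \<forall>g \<in> Hom C b c. \<forall>h \<in> Hom C c d.
      comp C a c d h (comp C a b c g f) = comp C a b d (comp C b c d h g) f)"

record ('o, 'm, 'p, 'n) fctr =
  obj_map :: "'o \<Rightarrow> 'p"
  hom_map :: "'o \<Rightarrow> 'o \<Rightarrow> 'm \<Rightarrow> 'n"

definition is_functor ::
    "('o, 'm) cat \<Rightarrow> ('p, 'n) cat \<Rightarrow> ('o, 'm, 'p, 'n) fctr \<Rightarrow> bool" where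
  "is_functor C D G \<longleftrightarrow> is_category C \<and> is_category D \<and>
    (\<forall>a \<in> Ob C. obj_map G a \<in> Ob D) \<and>
    (\<forall>a \<in> Ob C. \<forall>b \<in> Ob C. \<forall>f \<in> Hom C a b.
      hom_map G a b f \<in> Hom D (obj_map G a) (obj_map G b)) \<and>
    (\<forall>a \<in> Ob C. hom_map G a a (ident C a) = ident D (obj_map G a)) \<and>
    (\<forall>a \<in> Ob C. \<forall>b \<in> Ob C. \<forall>c \<in> Ob C. \<forall>f \<in> Hom C a b. \<forall>g \<in> Hom C b c.
      hom_map G a c (comp C a b c g f) =
      comp D (obj_map G a) (obj_map G b) (obj_map G c) (hom_map G b c g) (hom_map G a b f))"

type_synonym 'u pset = "'u set \<times> 'u"

definition Set_pt :: "('u pset, 'u \<Rightarrow> 'u) cat" where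
  "Set_pt = \<lparr>
    Ob = {(X, x). x \<in> X},
    Hom = (\<lambda>(X, x) (Y, y). {f \<in> X \<rightarrow>\<^sub>E Y. f x = y}),
    ident = (\<lambda>(X, x). \<lambda>u\<in>X. u),
    comp = (\<lambda>(X, x) (Y, y) (Z, z) g f. compose X g f)\<rparr>"

text \<open>To have finite cartesian products of pointed sets inside one HOL type, the elements are
  taken from a type closed under forming finite tuples; sets over an arbitrary type \<open>'x\<close>
  embed into it via \<open>Atom\<close>. A 1-tuple is identified with its entry, so that the product of
  a single factor is this factor itself.\<close>

datatype 'x elem = Atom 'x | Tuple "'x elem list"

definition tup :: "'x elem list \<Rightarrow> 'x elem" where
  "tup us = (if length us = 1 then hd us else Tuple us)"

definition entries :: "nat \<Rightarrow> 'x elem \<Rightarrow> 'x elem list" where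
  "entries n u = (if n = 1 then [u] else (case u of Tuple us \<Rightarrow> us | Atom _ \<Rightarrow> []))"

lemma entries_tup: "length us = n \<Longrightarrow> entries n (tup us) = us"
  by (cases us) (auto simp: entries_def tup_def)

definition pprod :: "'x elem pset list \<Rightarrow> 'x elem pset" where
  "pprod Ps = ({tup us | us. list_all2 (\<lambda>u P. u \<in> fst P) us Ps}, tup (map snd Ps))"

lemma pprod_single: "pprod [P] = P"
proof -
  have "fst (pprod [P]) = fst P"
    by (fastforce simp: pprod_def tup_def list_all2_Cons2 intro: exI[of _ "[_]"])
  then show ?thesis
    by (simp add: prod_eq_iff) (simp add: pprod_def tup_def)
qed

definition proj :: "'x elem pset list \<Rightarrow> nat \<Rightarrow> 'x elem \<Rightarrow> 'x elem" where
  "proj Ps i = (\<lambda>u \<in> fst (pprod Ps). entries (length Ps) u ! i)"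

definition pairing :: "'x elem pset \<Rightarrow> ('x elem \<Rightarrow> 'x elem) list \<Rightarrow> 'x elem \<Rightarrow> 'x elem" where
  "pairing P gs = (\<lambda>u \<in> fst P. tup (map (\<lambda>g. g u) gs))"

record ('f, 'a, 'x) osp =
  fobj :: "'a \<Rightarrow> 'x elem pset"
  fop :: "'f \<Rightarrow> 'a list \<Rightarrow> 'x elem \<Rightarrow> 'x elem"

definition hat :: "('f, 'a) alg \<Rightarrow> ('f, 'a, 'x) osp \<Rightarrow> ('f, 'x elem \<times> 'a) alg" where
  "hat A F = \<lparr>
    carrier = {(u, a). a \<in> carrier A \<and> u \<in> fst (fobj F a)},
    interp = (\<lambda>f ws. (fop F f (map snd ws) (tup (map fst ws)), interp A f (map snd ws)))\<rparr>"

definition outer_semidirect_product ::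
    "('f \<Rightarrow> nat) \<Rightarrow> ('f trm \<times> 'f trm) set \<Rightarrow> ('f, 'a) alg \<Rightarrow> ('f, 'a, 'x) osp \<Rightarrow> bool" where
  "outer_semidirect_product ar E A F \<longleftrightarrow>
    (\<forall>a \<in> carrier A. fobj F a \<in> Ob Set_pt) \<and>
    (\<forall>f as. length as = ar f \<and> set as \<subseteq> carrier A \<longrightarrow>
      fop F f as \<in> Hom Set_pt (pprod (map (fobj F) as)) (fobj F (interp A f as))) \<and>
    in_variety ar E (hat A F)"

text \<open>\<open>fterm A F as p\<close> is \<open>F(p)\<close> at the tuple \<open>as\<close>.\<close>

fun fterm ::
    "('f, 'a) alg \<Rightarrow> ('f, 'a, 'x) osp \<Rightarrow> 'a list \<Rightarrow> 'f trm \<Rightarrow> 'x elem \<Rightarrow> 'x elem" where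
  "fterm A F as (Var i) = proj (map (fobj F) as) i"
| "fterm A F as (App f ps) =
    compose (fst (pprod (map (fobj F) as)))
      (fop F f (map (\<lambda>p. term_op A p as) ps))
      (pairing (pprod (map (fobj F) as)) (map (fterm A F as) ps))"

definition enveloping :: "('f \<Rightarrow> nat) \<Rightarrow> ('f, 'a) alg \<Rightarrow> ('a list, 'f trm list) cat" where
  "enveloping ar A = \<lparr>
    Ob = {as. set as \<subseteq> carrier A},
    Hom = (\<lambda>as bs. {ps. length ps = length bs \<and>
      (\<forall>j < length bs. nary ar (length as) (ps ! j) \<and> term_op A (ps ! j) as = bs ! j)}),
    ident = (\<lambda>as. map Var [0..<length as]),
    comp = (\<lambda>as bs cs qs ps. map (subst ps) qs)\<rparr>"

definition extends ::
    "('f \<Rightarrow> nat) \<Rightarrow> ('f, 'a) alg \<Rightarrow> ('f, 'a, 'x) osp \<Rightarrow>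
     ('a list, 'f trm list, 'x elem pset, 'x elem \<Rightarrow> 'x elem) fctr \<Rightarrow> bool" where
  "extends ar A F G \<longleftrightarrow>
    (\<forall>a \<in> carrier A. obj_map G [a] = fobj F a) \<and>
    (\<forall>f as. length as = ar f \<and> set as \<subseteq> carrier A \<longrightarrow>
      hom_map G as [interp A f as] [App f (map Var [0..<ar f])] = fop F f as)"

end

theory Submission
  imports Defs
begin

text \<open>Applied to a tuple \<open>us\<close>, the map \<open>F(p)\<close> is the first component of the term operation of
  \<open>p\<close> on the algebra \<open>hat A F\<close>, whose second component is the term operation of \<open>p\<close> on \<open>A\<close>
  (\<open>eval_hat\<close>). All properties of \<open>G\<close> are thereby reduced to properties of term operations on a
  single algebra. Closure of \<open>hat A F\<close> under its operations says that \<open>F(p)\<close> takes values in the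
  right set. The map \<open>a \<mapsto> (x\<^sub>a, a)\<close> is a homomorphism \<open>A \<rightarrow> hat A F\<close>, because the maps
  \<open>f\<^bsub>(a\<^sub>1,...,a\<^sub>n)\<^esub>\<close> preserve base points; homomorphisms commute with term operations, so each \<open>F(p)\<close>
  preserves base points too. Finally, evaluating a substituted term amounts to evaluating the
  term at the values of the substituted terms (\<open>eval_subst\<close>); on \<open>hat A F\<close> this is
  compatibility of \<open>G\<close> with composition.\<close>

section \<open>Terms and the enveloping category\<close>

lemma eval_subst:
  assumes "nary ar (length ps) q"
  shows "eval B v (subst ps q) = eval B (\<lambda>i. map (eval B v) ps ! i) q"
  using assms by (induction q) (auto cong: map_cong)

lemma eval_closed:
  assumes "algebra ar B" "nary ar n p" "\<And>i. i < n \<Longrightarrow> v i \<in> carrier B"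
  shows "eval B v p \<in> carrier B"
  using assms(2)
proof (induction p)
  case (App f ts)
  then have "length (map (eval B v) ts) = ar f" "set (map (eval B v) ts) \<subseteq> carrier B"
    by auto
  then show ?case
    using assms(1) unfolding algebra_def eval.simps by blast
qed (use assms(3) in simp)

lemma nary_subst:
  assumes "nary ar (length ps) q" "\<And>p. p \<in> set ps \<Longrightarrow> nary ar n p"
  shows "nary ar n (subst ps q)"
  using assms by (induction q) auto

lemma subst_Var:
  assumes "nary ar n p"
  shows "subst (map Var [0..<n]) p = p"
  using assms by (induction p) (auto intro: map_idI)

lemma subst_subst:
  assumes "nary ar (length qs) r"
  shows "subst ps (subst qs r) = subst (map (subst ps) qs) r"
  using assms by (induction r) auto

lemma Ob_enveloping: "as \<in> Ob (enveloping ar A) \<longleftrightarrow> set as \<subseteq> carrier A"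
  by (simp add: enveloping_def)

text \<open>The target of a morphism is determined by its source and its terms.\<close>

lemma Hom_enveloping:
  "ps \<in> Hom (enveloping ar A) as bs \<longleftrightarrow>
    (\<forall>p \<in> set ps. nary ar (length as) p) \<and> bs = map (\<lambda>p. term_op A p as) ps"
proof -
  have "bs = map h ps \<longleftrightarrow> length ps = length bs \<and> (\<forall>j < length bs. h (ps ! j) = bs ! j)" for h
    by (subst list_eq_iff_nth_eq) auto
  then show ?thesis
    by (auto simp add: enveloping_def all_set_conv_all_nth)
qed

lemma is_category_enveloping: "is_category (enveloping ar A)"
proof -
  have comp_eq: "comp (enveloping ar A) as bs cs qs ps = map (subst ps) qs"
    and ident_eq: "ident (enveloping ar A) as = map Var [0..<length as]" for as bs cs qs ps
    by (simp_all add: enveloping_def)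
  show ?thesis
    unfolding is_category_def comp_eq ident_eq
  proof (intro conjI ballI)
    fix as
    show "map Var [0..<length as] \<in> Hom (enveloping ar A) as as"
      by (auto simp: Hom_enveloping o_def map_nth)
  next
    fix as bs cs ps qs
    assume "ps \<in> Hom (enveloping ar A) as bs" "qs \<in> Hom (enveloping ar A) bs cs"
    then show "map (subst ps) qs \<in> Hom (enveloping ar A) as cs"
      by (auto simp: Hom_enveloping eval_subst[where ar = ar] intro: nary_subst)
  next
    fix as bs ps
    assume ps: "ps \<in> Hom (enveloping ar A) as bs"
    then show "map (subst (map Var [0..<length as])) ps = ps"
      by (auto simp: Hom_enveloping intro: map_idI subst_Var)
    show "map (subst ps) (map Var [0..<length bs]) = ps"
      using ps by (simp add: Hom_enveloping o_def map_nth)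
  next
    fix as bs cs ds ps qs rs
    assume "qs \<in> Hom (enveloping ar A) bs cs" "rs \<in> Hom (enveloping ar A) cs ds"
    then show "map (subst (map (subst ps) qs)) rs = map (subst ps) (map (subst qs) rs)"
      by (auto simp: Hom_enveloping subst_subst[where ar = ar])
  qed
qed

section \<open>Pointed sets and their products\<close>

lemma Ob_Set_pt: "P \<in> Ob Set_pt \<longleftrightarrow> snd P \<in> fst P"
  by (auto simp: Set_pt_def)

lemma Hom_Set_pt: "f \<in> Hom Set_pt P Q \<longleftrightarrow> f \<in> fst P \<rightarrow>\<^sub>E fst Q \<and> f (snd P) = snd Q"
  by (auto simp: Set_pt_def split: prod.splits)

lemma ident_Set_pt: "ident Set_pt P = (\<lambda>u\<in>fst P. u)"
  by (simp add: Set_pt_def split: prod.splits)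

lemma comp_Set_pt: "comp Set_pt P Q R g f = compose (fst P) g f"
  by (simp add: Set_pt_def split: prod.splits)

lemma is_category_Set_pt: "is_category Set_pt"
  unfolding is_category_def ident_Set_pt comp_Set_pt
proof (intro conjI ballI)
  fix P :: "'a pset"
  assume "P \<in> Ob Set_pt"
  then show "(\<lambda>u\<in>fst P. u) \<in> Hom Set_pt P P"
    by (simp add: Ob_Set_pt Hom_Set_pt)
next
  fix P Q R :: "'a pset" and f g
  assume "P \<in> Ob Set_pt" "f \<in> Hom Set_pt P Q" "g \<in> Hom Set_pt Q R"
  then show "compose (fst P) g f \<in> Hom Set_pt P R"
    by (auto simp: Ob_Set_pt Hom_Set_pt PiE_def compose_eq intro: funcset_compose)
next
  fix P Q :: "'a pset" and f
  assume "f \<in> Hom Set_pt P Q"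
  then have "f \<in> fst P \<rightarrow> fst Q" "f \<in> extensional (fst P)"
    by (simp_all add: Hom_Set_pt PiE_def)
  then show "compose (fst P) f (\<lambda>u\<in>fst P. u) = f" "compose (fst P) (\<lambda>u\<in>fst Q. u) f = f"
    by (rule compose_Id Id_compose)+
next
  fix P Q R S :: "'a pset" and f g h
  assume "f \<in> Hom Set_pt P Q"
  then have "f \<in> fst P \<rightarrow> fst Q"
    by (simp add: Hom_Set_pt PiE_def)
  then show "compose (fst P) h (compose (fst P) g f) = compose (fst P) (compose (fst Q) h g) f"
    by (rule compose_assoc)
qed

lemma tup_single: "tup [u] = u"
  by (simp add: tup_def)

lemma fst_pprod_map:
  "fst (pprod (map X as)) = {tup us | us. list_all2 (\<lambda>u a. u \<in> fst (X a)) us as}"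
  by (simp add: pprod_def list.rel_map)

lemma snd_pprod_map: "snd (pprod (map X as)) = tup (map (\<lambda>a. snd (X a)) as)"
  by (simp add: pprod_def o_def)

lemma pprod_in_Ob_Set_pt:
  assumes "\<And>P. P \<in> set Ps \<Longrightarrow> P \<in> Ob Set_pt"
  shows "pprod Ps \<in> Ob Set_pt"
proof -
  have "list_all2 (\<lambda>u P. u \<in> fst P) (map snd Ps) Ps"
    using assms by (simp add: list_all2_conv_all_nth Ob_Set_pt)
  then show ?thesis
    by (auto simp: Ob_Set_pt pprod_def)
qed

lemma pairing_in_Hom_Set_pt:
  assumes "P \<in> Ob Set_pt" "\<And>q. q \<in> set qs \<Longrightarrow> h q \<in> Hom Set_pt P (X q)"
  shows "pairing P (map h qs) \<in> Hom Set_pt P (pprod (map X qs))"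
proof -
  have "list_all2 (\<lambda>u q. u \<in> fst (X q)) (map (\<lambda>q. h q u) qs) qs" if "u \<in> fst P" for u
    using assms(2) that by (auto simp: list.rel_map Hom_Set_pt intro!: list.rel_refl_strong)
  then have "pairing P (map h qs) \<in> fst P \<rightarrow>\<^sub>E fst (pprod (map X qs))"
    unfolding pairing_def fst_pprod_map by (fastforce simp: o_def)
  moreover have "pairing P (map h qs) (snd P) = snd (pprod (map X qs))"
    using assms by (auto simp: pairing_def snd_pprod_map Ob_Set_pt Hom_Set_pt o_def
        intro!: arg_cong[where f = tup])
  ultimately show ?thesis
    by (simp add: Hom_Set_pt)
qed

section \<open>Terms on an outer semidirect product\<close>

lemma interp_hat:
  "interp (hat A F) f ws = (fop F f (map snd ws) (tup (map fst ws)), interp A f (map snd ws))"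
  by (simp add: hat_def)

text \<open>The recursion defining \<open>F(p)\<close> is the recursion defining term operations on \<open>hat A F\<close>,
  with both coordinates computed together.\<close>

lemma eval_hat:
  assumes "list_all2 (\<lambda>u a. u \<in> fst (fobj F a)) us as"
  shows "eval (hat A F) (\<lambda>i. (us ! i, as ! i)) p = (fterm A F as p (tup us), term_op A p as)"
proof -
  have mem: "tup us \<in> fst (pprod (map (fobj F) as))"
    using assms by (auto simp: fst_pprod_map)
  have len: "length us = length as"
    using assms by (rule list_all2_lengthD)
  show ?thesis
  proof (induction p)
    case (Var i)
    \<comment> \<open>The first components agree also when \<open>i\<close> exceeds the length of the tuple: both are then the
      same unspecified value \<open>us ! i\<close>.\<close>
    then show ?case
      using mem len by (simp add: proj_def entries_tup)
  next
    case (App f ts)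
    have "map (eval (hat A F) (\<lambda>i. (us ! i, as ! i))) ts =
        map (\<lambda>t. (fterm A F as t (tup us), term_op A t as)) ts"
      using App by simp
    then show ?case
      using mem by (simp add: interp_hat compose_def pairing_def o_def cong: map_cong)
  qed
qed

lemma fterm_extensional: "fterm A F as p \<in> extensional (fst (pprod (map (fobj F) as)))"
  by (cases p) (simp_all add: proj_def compose_def)

text \<open>Base points form a copy of \<open>A\<close> inside \<open>hat A F\<close>.\<close>

lemma eval_hat_base:
  assumes A: "algebra ar A" and F: "outer_semidirect_product ar E A F"
    and p: "nary ar n p" and v: "\<And>i. i < n \<Longrightarrow> v i \<in> carrier A"
  shows "eval (hat A F) (\<lambda>i. (snd (fobj F (v i)), v i)) p =
    (snd (fobj F (eval A v p)), eval A v p)"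
  using p
proof (induction p)
  case (App f ts)
  let ?bs = "map (eval A v) ts"
  have "length ?bs = ar f" "set ?bs \<subseteq> carrier A"
    using App.prems A v by (auto intro!: eval_closed)
  then have "fop F f ?bs \<in> Hom Set_pt (pprod (map (fobj F) ?bs)) (fobj F (interp A f ?bs))"
    using F unfolding outer_semidirect_product_def by blast
  then have base: "fop F f ?bs (tup (map (\<lambda>t. snd (fobj F (eval A v t))) ts)) =
      snd (fobj F (interp A f ?bs))"
    by (simp only: Hom_Set_pt snd_pprod_map list.map_comp o_def)
  have "map (eval (hat A F) (\<lambda>i. (snd (fobj F (v i)), v i))) ts =
      map (\<lambda>t. (snd (fobj F (eval A v t)), eval A v t)) ts"
    using App by simp
  then show ?case
    using base by (simp add: interp_hat o_def cong: map_cong)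
qed simp

lemma fterm_in_Hom:
  assumes A: "algebra ar A" and F: "outer_semidirect_product ar E A F"
    and as: "set as \<subseteq> carrier A" and p: "nary ar (length as) p"
  shows "fterm A F as p \<in> Hom Set_pt (pprod (map (fobj F) as)) (fobj F (term_op A p as))"
proof -
  have as_nth: "as ! i \<in> carrier A" if "i < length as" for i
    using as that by auto
  have hat: "algebra ar (hat A F)"
    using F by (simp add: outer_semidirect_product_def in_variety_def)
  have "fterm A F as p (tup us) \<in> fst (fobj F (term_op A p as))"
    if us: "list_all2 (\<lambda>u a. u \<in> fst (fobj F a)) us as" for us
  proof -
    have "eval (hat A F) (\<lambda>i. (us ! i, as ! i)) p \<in> carrier (hat A F)"
      using hat p by (rule eval_closed)
        (use us as_nth in \<open>auto simp: hat_def list_all2_conv_all_nth\<close>)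
    then show ?thesis
      by (simp add: eval_hat[OF us]) (simp add: hat_def)
  qed
  then have "fterm A F as p \<in> fst (pprod (map (fobj F) as)) \<rightarrow>\<^sub>E fst (fobj F (term_op A p as))"
    using fterm_extensional[of A F as p] by (auto simp: PiE_iff fst_pprod_map)
  moreover have "fterm A F as p (tup (map (\<lambda>a. snd (fobj F a)) as)) = snd (fobj F (term_op A p as))"
  proof -
    let ?xs = "map (\<lambda>a. snd (fobj F a)) as"
    have xs: "list_all2 (\<lambda>u a. u \<in> fst (fobj F a)) ?xs as"
      using F as by (auto simp: list.rel_map outer_semidirect_product_def Ob_Set_pt
          intro!: list.rel_refl_strong)
    have "eval (hat A F) (\<lambda>i. (?xs ! i, as ! i)) p =
        eval (hat A F) (\<lambda>i. (snd (fobj F (as ! i)), as ! i)) p"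
      using p by (induction p) (auto cong: map_cong)
    also have "\<dots> = (snd (fobj F (term_op A p as)), term_op A p as)"
      using A F p as_nth by (rule eval_hat_base)
    finally show ?thesis
      by (simp add: eval_hat[OF xs])
  qed
  ultimately show ?thesis
    by (simp add: Hom_Set_pt snd_pprod_map)
qed

text \<open>Substitution of terms turns into composition of maps; this is \<open>eval_subst\<close> on \<open>hat A F\<close>, read
  in the first coordinate.\<close>

lemma fterm_subst:
  assumes us: "list_all2 (\<lambda>u a. u \<in> fst (fobj F a)) us as"
    and vs: "list_all2 (\<lambda>u b. u \<in> fst (fobj F b)) (map (\<lambda>p. fterm A F as p (tup us)) ps)
      (map (\<lambda>p. term_op A p as) ps)"
    and q: "nary ar (length ps) q"
  shows "fterm A F as (subst ps q) (tup us) =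
    fterm A F (map (\<lambda>p. term_op A p as) ps) q (tup (map (\<lambda>p. fterm A F as p (tup us)) ps))"
proof -
  let ?vs = "map (\<lambda>p. fterm A F as p (tup us)) ps"
  let ?bs = "map (\<lambda>p. term_op A p as) ps"
  have "eval (hat A F) (\<lambda>i. (us ! i, as ! i)) (subst ps q) =
      eval (hat A F) (\<lambda>i. map (\<lambda>p. (fterm A F as p (tup us), term_op A p as)) ps ! i) q"
    by (simp add: eval_subst[OF q] eval_hat[OF us] cong: map_cong)
  also have "\<dots> = eval (hat A F) (\<lambda>i. (?vs ! i, ?bs ! i)) q"
    using q by (induction q) (auto cong: map_cong)
  finally show ?thesis
    by (simp add: eval_hat[OF us] eval_hat[OF vs])
qed

section \<open>The functor on the enveloping category\<close>

definition extension ::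
    "('f, 'a) alg \<Rightarrow> ('f, 'a, 'x) osp \<Rightarrow>
     ('a list, 'f trm list, 'x elem pset, 'x elem \<Rightarrow> 'x elem) fctr" where
  "extension A F = \<lparr>
    obj_map = (\<lambda>as. pprod (map (fobj F) as)),
    hom_map = (\<lambda>as bs ps. pairing (pprod (map (fobj F) as)) (map (fterm A F as) ps))\<rparr>"

lemma pprod_fobj_in_Ob_Set_pt:
  assumes "outer_semidirect_product ar E A F" "as \<in> Ob (enveloping ar A)"
  shows "pprod (map (fobj F) as) \<in> Ob Set_pt"
proof (rule pprod_in_Ob_Set_pt)
  fix P assume "P \<in> set (map (fobj F) as)"
  then obtain a where "P = fobj F a" "a \<in> carrier A"
    using assms(2) by (auto simp: Ob_enveloping)
  then show "P \<in> Ob Set_pt"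
    using assms(1) by (simp add: outer_semidirect_product_def)
qed

lemma map_projections_tup:
  assumes "list_all2 (\<lambda>u a. u \<in> fst (fobj F a)) us as"
  shows "map (\<lambda>i. fterm A F as (Var i) (tup us)) [0..<length as] = us"
proof -
  have "tup us \<in> fst (pprod (map (fobj F) as))" "length us = length as"
    using assms by (auto simp: fst_pprod_map dest: list_all2_lengthD)
  then show ?thesis
    by (auto simp: proj_def entries_tup intro: nth_equalityI)
qed

lemma hom_map_extension_tup:
  assumes "list_all2 (\<lambda>u a. u \<in> fst (fobj F a)) us as"
  shows "hom_map (extension A F) as bs ps (tup us) = tup (map (\<lambda>p. fterm A F as p (tup us)) ps)"
  using assms by (auto simp: extension_def pairing_def fst_pprod_map o_def)

lemma is_functor_extension:
  assumes A: "algebra ar A" and F: "outer_semidirect_product ar E A F"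
  shows "is_functor (enveloping ar A) Set_pt (extension A F)"
  unfolding is_functor_def
proof (intro conjI ballI)
  show "is_category (enveloping ar A)" "is_category Set_pt"
    by (rule is_category_enveloping is_category_Set_pt)+
next
  fix as assume "as \<in> Ob (enveloping ar A)"
  then show "obj_map (extension A F) as \<in> Ob Set_pt"
    using F pprod_fobj_in_Ob_Set_pt by (simp add: extension_def)
  show "hom_map (extension A F) as as (ident (enveloping ar A) as) =
      ident Set_pt (obj_map (extension A F) as)"
  proof (rule extensionalityI)
    fix u assume "u \<in> fst (pprod (map (fobj F) as))"
    then obtain us where us: "u = tup us" "list_all2 (\<lambda>u a. u \<in> fst (fobj F a)) us as"
      by (auto simp: fst_pprod_map)
    then show "hom_map (extension A F) as as (ident (enveloping ar A) as) u =
        ident Set_pt (obj_map (extension A F) as) u"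
      using map_projections_tup[OF us(2), of A] \<open>u \<in> _\<close>
      by (simp add: hom_map_extension_tup enveloping_def o_def del: fterm.simps)
        (simp add: ident_Set_pt extension_def)
  qed (simp_all add: extension_def pairing_def ident_Set_pt)
next
  fix as bs ps
  assume as: "as \<in> Ob (enveloping ar A)"
    and ps: "ps \<in> Hom (enveloping ar A) as bs"
  have "pprod (map (fobj F) as) \<in> Ob Set_pt"
    using F as by (rule pprod_fobj_in_Ob_Set_pt)
  then have "pairing (pprod (map (fobj F) as)) (map (fterm A F as) ps) \<in>
      Hom Set_pt (pprod (map (fobj F) as)) (pprod (map (\<lambda>p. fobj F (term_op A p as)) ps))"
    using A F as ps
    by (intro pairing_in_Hom_Set_pt fterm_in_Hom) (auto simp: Ob_enveloping Hom_enveloping)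
  then show hom: "hom_map (extension A F) as bs ps \<in>
      Hom Set_pt (obj_map (extension A F) as) (obj_map (extension A F) bs)"
    using ps by (simp add: extension_def Hom_enveloping o_def)
  fix cs qs
  assume qs: "qs \<in> Hom (enveloping ar A) bs cs"
  show "hom_map (extension A F) as cs (comp (enveloping ar A) as bs cs qs ps) =
      comp Set_pt (obj_map (extension A F) as) (obj_map (extension A F) bs)
        (obj_map (extension A F) cs) (hom_map (extension A F) bs cs qs)
        (hom_map (extension A F) as bs ps)"
  proof (rule extensionalityI)
    fix u assume u: "u \<in> fst (pprod (map (fobj F) as))"
    then obtain us where us: "u = tup us" "list_all2 (\<lambda>u a. u \<in> fst (fobj F a)) us as"
      by (auto simp: fst_pprod_map)
    let ?vs = "map (\<lambda>p. fterm A F as p (tup us)) ps"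
    have bs: "bs = map (\<lambda>p. term_op A p as) ps"
      using ps by (simp add: Hom_enveloping)
    have vs: "list_all2 (\<lambda>u b. u \<in> fst (fobj F b)) ?vs bs"
      unfolding bs list.rel_map
    proof (rule list.rel_refl_strong)
      fix p assume "p \<in> set ps"
      then have "fterm A F as p \<in> Hom Set_pt (pprod (map (fobj F) as)) (fobj F (term_op A p as))"
        using A F as ps by (intro fterm_in_Hom) (auto simp: Ob_enveloping Hom_enveloping)
      then show "fterm A F as p (tup us) \<in> fst (fobj F (term_op A p as))"
        using u us(1) by (auto simp: Hom_Set_pt)
    qed
    have "fterm A F as (subst ps q) (tup us) = fterm A F bs q (tup ?vs)" if "q \<in> set qs" for q
      using that qs vs unfolding bs by (intro fterm_subst[OF us(2)]) (auto simp: Hom_enveloping)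
    then have "hom_map (extension A F) as cs (map (subst ps) qs) u =
        hom_map (extension A F) bs cs qs (hom_map (extension A F) as bs ps u)"
      by (simp add: us(1) hom_map_extension_tup[OF us(2)] hom_map_extension_tup[OF vs] o_def
          cong: map_cong)
    then show "hom_map (extension A F) as cs (comp (enveloping ar A) as bs cs qs ps) u =
        comp Set_pt (obj_map (extension A F) as) (obj_map (extension A F) bs)
          (obj_map (extension A F) cs) (hom_map (extension A F) bs cs qs)
          (hom_map (extension A F) as bs ps) u"
      using u by (simp add: enveloping_def comp_Set_pt compose_def)
        (simp add: extension_def)
  qed (simp_all add: extension_def pairing_def comp_Set_pt compose_def)
qed

text \<open>On the variables \<open>x\<^sub>1, ..., x\<^sub>n\<close> the tuple of the values of \<open>F\<close> is the tuple of the projections,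
  which is the identity map, so that \<open>F(f(x\<^sub>1, ..., x\<^sub>n))\<close> is the given map of \<open>f\<close>. On objects
  the extension property rests on the identification of a 1-tuple with its entry.\<close>

lemma extends_extension:
  assumes F: "outer_semidirect_product ar E A F"
  shows "extends ar A F (extension A F)"
  unfolding extends_def
proof (intro conjI ballI allI impI)
  fix a
  show "obj_map (extension A F) [a] = fobj F a"
    by (simp add: extension_def pprod_single)
next
  fix f as
  assume as: "length as = ar f \<and> set as \<subseteq> carrier A"
  let ?P = "pprod (map (fobj F) as)"
  have fop: "fop F f as \<in> Hom Set_pt ?P (fobj F (interp A f as))"
    using F as unfolding outer_semidirect_product_def by blast
  show "hom_map (extension A F) as [interp A f as] [App f (map Var [0..<ar f])] = fop F f as"
  proof (rule extensionalityI)
    show "fop F f as \<in> extensional (fst ?P)"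
      using fop by (simp add: Hom_Set_pt PiE_iff)
    fix u assume u: "u \<in> fst ?P"
    then obtain us where us: "u = tup us" "list_all2 (\<lambda>u a. u \<in> fst (fobj F a)) us as"
      by (auto simp: fst_pprod_map)
    have bs: "map (\<lambda>i. as ! i) [0..<ar f] = as"
      using as map_nth[of as] by simp
    have vs: "map (\<lambda>i. proj (map (fobj F) as) i (tup us)) [0..<ar f] = us"
      using map_projections_tup[OF us(2), of A] as by simp
    have "fterm A F as (App f (map Var [0..<ar f])) u = fop F f as u"
      using u by (simp add: compose_def pairing_def o_def bs vs us(1))
    then show "hom_map (extension A F) as [interp A f as] [App f (map Var [0..<ar f])] u = fop F f as u"
      by (simp add: us(1) hom_map_extension_tup[OF us(2)] tup_single del: fterm.simps)
  qed (simp add: extension_def pairing_def)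
qed

theorem theorem4p2:
  fixes ar :: "'f \<Rightarrow> nat"
    and E :: "('f trm \<times> 'f trm) set"
    and A :: "('f, 'a) alg"
    and F :: "('f, 'a, 'x) osp"
  assumes "identities ar E"
    and "in_variety ar E A"
    and "outer_semidirect_product ar E A F"
  shows "\<exists>G. is_functor (enveloping ar A) Set_pt G \<and>
    extends ar A F G \<and>
    (\<forall>as \<in> Ob (enveloping ar A). obj_map G as = pprod (map (fobj F) as)) \<and>
    (\<forall>as \<in> Ob (enveloping ar A). \<forall>bs \<in> Ob (enveloping ar A).
      \<forall>ps \<in> Hom (enveloping ar A) as bs.
        hom_map G as bs ps = pairing (pprod (map (fobj F) as)) (map (fterm A F as) ps))"
proof -
  have "algebra ar A"
    using assms(2) by (simp add: in_variety_def)
  then have "is_functor (enveloping ar A) Set_pt (extension A F)"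
    using assms(3) by (rule is_functor_extension)
  moreover have "extends ar A F (extension A F)"
    using assms(3) by (rule extends_extension)
  ultimately show ?thesis
    by (intro exI[of _ "extension A F"]) (simp add: extension_def)
qed

end
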